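(* Suppose that $u\in C([0,T];W_0^{1,\infty}(\Omega))$, that the nodal points of the finite element spaces $\Psi_h^0,\dots,\Psi_h^{N_T}$ are given by a moving mesh, and that $\Delta t\,|u|_{C(W^{1,\infty})}\le1/8$. For a given initial datum $\phi_h^0\in\Psi_h^0$, let $\{\phi_h^n\}_{n=1}^{N_T}$, $\phi_h^n\in\Psi_h^n$, be the solution of the first-order scheme $$\left(\frac{\phi_h^n-(\phi_h^{n-1}\circ X_1^n)\gamma^n}{\Delta t},\psi_h\right)+\nu(\nabla\phi_h^n,\nabla\psi_h)=(f^n,\psi_h)+\int_\Gamma g^n\psi_h\,ds\qquad\forall\psi_h\in\Psi_h^n,\quad n=1,\dots,N_T .$$ Then for $n=0,1,\dots,N_T$ $$\int_\Omega\phi_h^n\,dx=\int_\Omega\phi_h^0\,dx+\Delta t\sum_{i=1}^n\left(\int_\Omega f^i\,dx+\int_\Gamma g^i\,ds\right).$$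
   Context: $\Omega=(a,b)$ is a bounded interval, $\Gamma=\{a,b\}$ (so $\int_\Gamma g\,ds=g(a)+g(b)$), $T>0$, $\nu>0$; $u,f:\Omega\times(0,T)\to\mathbb{R}$ and $g:\Gamma\times(0,T)\to\mathbb{R}$ are given functions with $f(\cdot,t)\in L^2(\Omega)$, $g(\cdot,t)\in L^2(\Gamma)$. $(\cdot,\cdot)$ is the $L^2(\Omega)$ inner product and $\nabla=\partial_x$. $W_0^{1,\infty}(\Omega)$ consists of the $W^{1,\infty}(\Omega)$ functions vanishing at $a,b$, and $|u|_{C(W^{1,\infty})}=\sup_{t\in[0,T]}\|\partial_xu(\cdot,t)\|_{L^\infty(\Omega)}$. $\Delta t>0$, $t^n=n\Delta t$, $N_T=\lfloor T/\Delta t\rfloor$, $\rho^n=\rho(\cdot,t^n)$. A moving mesh is a set of points $\{P_i^n: i=1,\dots,N_p,\ n=0,\dots,N_T\}\subset\bar\Omega$ with $a=P_1^n<\dots<P_{N_p}^n=b$ for every $n$. $\Psi_h^n$ is the space of continuous functions on $\bar\Omega$ that are affine on each $[P_i^n,P_{i+1}^n]$. The upwind map is $X_1^n(x)=x-u^n(x)\Delta t$, with Jacobian $\gamma^n(x)=\partial_xX_1^n(x)$. *)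

theory Defs
  imports "HOL-Analysis.Analysis" "HOL-Probability.Essential_Supremum"
begin

(* Functions of space are total functions real => real; only their values on [a,b] matter.
   Functions of space and time take time first, so that u t denotes u(.,t). *)

definition test_function :: "real \<Rightarrow> real \<Rightarrow> (real \<Rightarrow> real) \<Rightarrow> bool" where
  "test_function a b \<phi> \<longleftrightarrow>
     (\<forall>k. (deriv ^^ k) \<phi> differentiable_on UNIV) \<and>
     (\<exists>K. compact K \<and> K \<subseteq> {a<..<b} \<and> (\<forall>x. x \<notin> K \<longrightarrow> \<phi> x = 0))"

definition loc_integrable :: "real \<Rightarrow> real \<Rightarrow> (real \<Rightarrow> real) \<Rightarrow> bool" where
  "loc_integrable a b v \<longleftrightarrow>
     (\<forall>K. compact K \<and> K \<subseteq> {a<..<b} \<longrightarrow> v absolutely_integrable_on K)"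

definition has_weak_deriv :: "real \<Rightarrow> real \<Rightarrow> (real \<Rightarrow> real) \<Rightarrow> (real \<Rightarrow> real) \<Rightarrow> bool" where
  "has_weak_deriv a b v w \<longleftrightarrow>
     loc_integrable a b v \<and> loc_integrable a b w \<and>
     (\<forall>\<phi>. test_function a b \<phi> \<longrightarrow>
        (LINT x|lebesgue_on {a<..<b}. v x * deriv \<phi> x) =
        - (LINT x|lebesgue_on {a<..<b}. w x * \<phi> x))"

(* Weak derivatives are unique up to null sets; one representative is chosen here.
   It is only ever used under integrals and essential suprema. *)
definition weak_deriv :: "real \<Rightarrow> real \<Rightarrow> (real \<Rightarrow> real) \<Rightarrow> real \<Rightarrow> real" where
  "weak_deriv a b v = (SOME w. has_weak_deriv a b v w)"

definition L2 :: "real \<Rightarrow> real \<Rightarrow> (real \<Rightarrow> real) set" where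
  "L2 a b = {v \<in> borel_measurable (lebesgue_on {a<..<b}).
               integrable (lebesgue_on {a<..<b}) (\<lambda>x. (v x)\<^sup>2)}"

definition L2_inner :: "real \<Rightarrow> real \<Rightarrow> (real \<Rightarrow> real) \<Rightarrow> (real \<Rightarrow> real) \<Rightarrow> real" where
  "L2_inner a b v w = (LINT x|lebesgue_on {a<..<b}. v x * w x)"

(* Extended-real valued: equal to \<infinity> if v is not essentially bounded or not measurable. *)
definition Linf_norm :: "real \<Rightarrow> real \<Rightarrow> (real \<Rightarrow> real) \<Rightarrow> ereal" where
  "Linf_norm a b v = esssup (lebesgue_on {a<..<b}) (\<lambda>x. ereal \<bar>v x\<bar>)"

definition Linf :: "real \<Rightarrow> real \<Rightarrow> (real \<Rightarrow> real) set" where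
  "Linf a b = {v \<in> borel_measurable (lebesgue_on {a<..<b}). Linf_norm a b v < \<infinity>}"

definition W1inf :: "real \<Rightarrow> real \<Rightarrow> (real \<Rightarrow> real) set" where
  "W1inf a b = {v \<in> Linf a b. \<exists>w \<in> Linf a b. has_weak_deriv a b v w}"

definition W1inf_norm :: "real \<Rightarrow> real \<Rightarrow> (real \<Rightarrow> real) \<Rightarrow> ereal" where
  "W1inf_norm a b v = max (Linf_norm a b v) (Linf_norm a b (weak_deriv a b v))"

(* Members of W^{1,\<infinity>} are represented by their continuous representative on [a,b], so that
   the boundary values, and the pointwise values used by the upwind map, make sense. *)
definition W1inf0 :: "real \<Rightarrow> real \<Rightarrow> (real \<Rightarrow> real) set" where
  "W1inf0 a b = {v \<in> W1inf a b. continuous_on {a..b} v \<and> v a = 0 \<and> v b = 0}"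

definition C_W1inf0 :: "real \<Rightarrow> real \<Rightarrow> real \<Rightarrow> (real \<Rightarrow> real \<Rightarrow> real) set" where
  "C_W1inf0 T a b = {u. \<forall>t \<in> {0..T}. u t \<in> W1inf0 a b \<and>
     ((\<lambda>s. W1inf_norm a b (\<lambda>x. u s x - u t x)) \<longlongrightarrow> 0) (at t within {0..T})}"

definition C_W1inf_seminorm :: "real \<Rightarrow> real \<Rightarrow> real \<Rightarrow> (real \<Rightarrow> real \<Rightarrow> real) \<Rightarrow> ereal" where
  "C_W1inf_seminorm T a b u = (SUP t \<in> {0..T}. Linf_norm a b (weak_deriv a b (u t)))"

(* The integral over the boundary {a,b} with respect to counting measure; every function on
   {a,b} is square integrable for it. *)
definition boundary_integral :: "real \<Rightarrow> real \<Rightarrow> (real \<Rightarrow> real) \<Rightarrow> real" where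
  "boundary_integral a b h = h a + h b"

definition num_steps :: "real \<Rightarrow> real \<Rightarrow> nat" where
  "num_steps T \<Delta>t = nat \<lfloor>T / \<Delta>t\<rfloor>"

(* P n i is the i-th node (i = 1..Np) at time level n. *)
definition moving_mesh :: "real \<Rightarrow> real \<Rightarrow> nat \<Rightarrow> nat \<Rightarrow> (nat \<Rightarrow> nat \<Rightarrow> real) \<Rightarrow> bool" where
  "moving_mesh a b N Np P \<longleftrightarrow> 2 \<le> Np \<and>
     (\<forall>n \<le> N. P n 1 = a \<and> P n Np = b \<and> (\<forall>i \<in> {1..<Np}. P n i < P n (i + 1)))"

definition P1_space :: "real \<Rightarrow> real \<Rightarrow> nat \<Rightarrow> (nat \<Rightarrow> real) \<Rightarrow> (real \<Rightarrow> real) set" where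
  "P1_space a b Np p = {\<psi>. continuous_on {a..b} \<psi> \<and>
     (\<forall>i \<in> {1..<Np}. \<exists>c d. \<forall>x \<in> {p i..p (i + 1)}. \<psi> x = c + d * x)}"

definition upwind_map :: "real \<Rightarrow> (real \<Rightarrow> real) \<Rightarrow> real \<Rightarrow> real" where
  "upwind_map \<Delta>t v x = x - v x * \<Delta>t"

definition upwind_jacobian :: "real \<Rightarrow> real \<Rightarrow> real \<Rightarrow> (real \<Rightarrow> real) \<Rightarrow> real \<Rightarrow> real" where
  "upwind_jacobian a b \<Delta>t v = weak_deriv a b (upwind_map \<Delta>t v)"

end

theory Submission
  imports Defs "HOL-Computational_Algebra.Polynomial"
begin

text \<open>
  Testing the scheme with \<open>\<psi> = 1\<close> removes the diffusion term, so everything rests on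
  \<open>\<integral> (\<phi> \<circ> X) \<gamma> = \<integral> \<phi>\<close> for the upwind map \<open>X\<close> and its weak Jacobian \<open>\<gamma>\<close>. Testing against
  differences of steep smooth ramps shows that a weak derivative of a continuous function
  integrates to its increments; hence weak derivatives are unique almost everywhere and
  \<open>X d - X c\<close> is the integral of \<open>\<gamma>\<close> over \<open>[c, d]\<close>. The CFL condition makes \<open>\<gamma>\<close> bounded and
  positive, so \<open>X\<close> maps \<open>[a, b]\<close> into itself and fixes the endpoints. If \<open>G\<close> is the primitive
  of \<open>\<phi>\<close>, then \<open>G (X y)\<close> minus the integral of \<open>(\<phi> \<circ> X) \<gamma>\<close> up to \<open>y\<close> has derivative zero
  everywhere, although \<open>X\<close> itself need not be differentiable everywhere.
\<close>

section \<open>A smooth step function\<close>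

text \<open>Level \<open>0\<close> already demands one derivative, so level \<open>k\<close> grants
  \<open>k + 1\<close> of them. Peeling off the innermost derivative lets inductions with arbitrary
  \<open>f\<close> apply their hypothesis to \<open>deriv f\<close>.\<close>

primrec times_differentiable :: "nat \<Rightarrow> (real \<Rightarrow> real) \<Rightarrow> bool" where
  "times_differentiable 0 f \<longleftrightarrow> f differentiable_on UNIV"
| "times_differentiable (Suc k) f \<longleftrightarrow> f differentiable_on UNIV \<and> times_differentiable k (deriv f)"

lemma times_differentiable_imp_differentiable:
  "times_differentiable k f \<Longrightarrow> f differentiable_on UNIV"
  by (cases k) auto

text \<open>Link to the iterated \<open>deriv\<close> in \<open>test_function\<close>.\<close>

lemma times_differentiable_imp_funpow_deriv:
  "times_differentiable k f \<Longrightarrow> (deriv ^^ k) f differentiable_on UNIV"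
  by (induction k arbitrary: f) (auto simp: funpow_swap1)

lemma times_differentiable_lessD:
  "times_differentiable (Suc k) f \<Longrightarrow> times_differentiable k f"
  by (induction k arbitrary: f) auto

lemma differentiable_on_UNIV_deriv:
  fixes f :: "real \<Rightarrow> real"
  shows "f differentiable_on UNIV \<Longrightarrow> (f has_real_derivative deriv f x) (at x)"
  by (simp add: DERIV_deriv_iff_real_differentiable differentiable_on_def)

text \<open>An explicit derivative at every point equals \<open>deriv f\<close> as a function, so
  closed formulas can drive the inductions.\<close>

lemma times_differentiable_SucI:
  assumes "\<And>x. (f has_real_derivative f' x) (at x)" "times_differentiable k f'"
  shows "times_differentiable (Suc k) f"
proof -
  have "deriv f = f'" using assms(1) by (auto intro!: DERIV_imp_deriv)
  then show ?thesis
    using assms by (auto simp: differentiable_on_def real_differentiable_def)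
qed

lemma times_differentiable_const: "times_differentiable k (\<lambda>x. c)"
proof (induction k arbitrary: c)
  case (Suc k)
  show ?case by (rule times_differentiable_SucI[where f' = "\<lambda>x. 0"]) (auto intro: Suc)
qed auto

lemma DERIV_affine:
  assumes "(f has_real_derivative D) (at (m * x + c))"
  shows "((\<lambda>x. f (m * x + c)) has_real_derivative D * m) (at x)"
  by (rule DERIV_chain2[where g = "\<lambda>x. m * x + c", OF assms]) (auto intro!: derivative_eq_intros)

text \<open>The factor \<open>r\<close> makes the induction close: each differentiation produces a
  factor \<open>m\<close>, which is absorbed into it.\<close>

lemma times_differentiable_affine:
  "times_differentiable k f \<Longrightarrow> times_differentiable k (\<lambda>x. r * f (m * x + c))"
proof (induction k arbitrary: f r)
  case 0
  then have "((\<lambda>x. r * f (m * x + c)) has_real_derivative r * (deriv f (m * x + c) * m)) (at x)" for x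
    by (intro DERIV_cmult DERIV_affine differentiable_on_UNIV_deriv) simp
  then show ?case by (auto simp: differentiable_on_def real_differentiable_def)
next
  case (Suc k)
  have "times_differentiable k (\<lambda>x. (r * m) * deriv f (m * x + c))"
    using Suc by auto
  moreover have "((\<lambda>x. r * f (m * x + c)) has_real_derivative (r * m) * deriv f (m * x + c)) (at x)" for x
    using DERIV_cmult[OF DERIV_affine[OF differentiable_on_UNIV_deriv], of f r m c x] Suc.prems
    by (simp add: mult_ac)
  ultimately show ?case by (intro times_differentiable_SucI)
qed

lemma times_differentiable_add:
  "times_differentiable k f \<Longrightarrow> times_differentiable k g \<Longrightarrow> times_differentiable k (\<lambda>x. f x + g x)"
proof (induction k arbitrary: f g)
  case (Suc k)
  show ?case
  proof (rule times_differentiable_SucI)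
    show "((\<lambda>x. f x + g x) has_real_derivative deriv f x + deriv g x) (at x)" for x
      using Suc.prems by (intro DERIV_add differentiable_on_UNIV_deriv) auto
    show "times_differentiable k (\<lambda>x. deriv f x + deriv g x)"
      using Suc by auto
  qed
qed (auto intro: differentiable_on_add)

lemma times_differentiable_mult:
  "times_differentiable k f \<Longrightarrow> times_differentiable k g \<Longrightarrow> times_differentiable k (\<lambda>x. f x * g x)"
proof (induction k arbitrary: f g)
  case (Suc k)
  show ?case
  proof (rule times_differentiable_SucI[where f' = "\<lambda>x. deriv f x * g x + f x * deriv g x"])
    show "((\<lambda>x. f x * g x) has_real_derivative deriv f x * g x + f x * deriv g x) (at x)" for x
      using DERIV_mult[OF differentiable_on_UNIV_deriv[of f] differentiable_on_UNIV_deriv[of g]] Suc.prems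
      by (simp add: mult.commute)
    show "times_differentiable k (\<lambda>x. deriv f x * g x + f x * deriv g x)"
      using Suc.prems Suc.prems[THEN times_differentiable_lessD]
      by (intro times_differentiable_add Suc.IH) simp_all
  qed
qed (auto intro: differentiable_on_mult)

text \<open>The derivative of the reciprocal contains the reciprocal itself, but one level lower,
  where the induction hypothesis covers it.\<close>

lemma times_differentiable_inverse:
  "times_differentiable k f \<Longrightarrow> (\<And>x. f x \<noteq> 0) \<Longrightarrow> times_differentiable k (\<lambda>x. inverse (f x))"
proof (induction k arbitrary: f)
  case 0
  then show ?case
    by (auto simp: differentiable_on_def intro!: differentiable_inverse)
next
  case (Suc k)
  show ?case
  proof (rule times_differentiable_SucI[where f' = "\<lambda>x. - 1 * deriv f (1 * x + 0) * (inverse (f x) * inverse (f x))"])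
    show "((\<lambda>x. inverse (f x)) has_real_derivative - 1 * deriv f (1 * x + 0) * (inverse (f x) * inverse (f x))) (at x)" for x
      using DERIV_inverse'[OF differentiable_on_UNIV_deriv[of f]] Suc.prems
      by (simp add: mult.commute mult.left_commute)
    show "times_differentiable k (\<lambda>x. - 1 * deriv f (1 * x + 0) * (inverse (f x) * inverse (f x)))"
      using Suc.prems times_differentiable_lessD[OF Suc.prems(1)]
      by (intro times_differentiable_mult times_differentiable_affine Suc.IH) auto
  qed
qed

section \<open>Functions flat at the origin\<close>

text \<open>This family is closed under differentiation, which gives smoothness at \<open>0\<close>.\<close>

definition flat :: "real poly \<Rightarrow> real \<Rightarrow> real" where
  "flat p x = (if x > 0 then poly p (1 / x) * exp (- 1 / x) else 0)"

text \<open>From the right, \<open>y = 1 / x\<close> reduces the claim to the exponential beating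
  every power at infinity; from the left the function is zero.\<close>

lemma flat_0: "(flat p \<longlongrightarrow> 0) (at 0)"
proof -
  have *: "((\<lambda>y. poly p y * exp (- y)) \<longlongrightarrow> 0) at_top"
  proof -
    have "((\<lambda>y. \<Sum>i\<le>degree p. coeff p i * (y ^ i / exp y)) \<longlongrightarrow> (\<Sum>i\<le>degree p. coeff p i * 0)) at_top"
      by (intro tendsto_intros tendsto_power_div_exp_0)
    then show ?thesis by (simp add: poly_altdef sum_distrib_right exp_minus divide_inverse mult.assoc)
  qed
  have "((\<lambda>x. poly p (inverse x) * exp (- inverse x)) \<longlongrightarrow> 0) (at_right 0)"
    using filterlim_compose[OF * filterlim_inverse_at_top_right] .
  then have 1: "(flat p \<longlongrightarrow> 0) (at_right 0)"
    by (rule Lim_transform_eventually)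
       (auto simp: flat_def eventually_at_filter divide_inverse)
  have 2: "(flat p \<longlongrightarrow> 0) (at_left 0)"
    by (rule Lim_transform_eventually[OF tendsto_const])
       (auto simp: flat_def eventually_at_filter)
  show ?thesis using 1 2 by (simp add: filterlim_split_at)
qed

text \<open>With \<open>y = 1 / x\<close> one has \<open>dy/dx = - y^2\<close>, so differentiating
  \<open>p(y) exp(-y)\<close> gives \<open>y^2 (p(y) - p'(y)) exp(-y)\<close>; the factor
  \<open>[:0, 0, 1:]\<close> is \<open>y^2\<close>.\<close>

lemma DERIV_flat: "(flat p has_real_derivative flat ([:0, 0, 1:] * (p - pderiv p)) x) (at x)"
proof (cases x "0 :: real" rule: linorder_cases)
  case less
  have "((\<lambda>x. 0) has_real_derivative 0) (at x)" by simp
  then have "(flat p has_real_derivative 0) (at x)"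
    by (rule has_field_derivative_transform_within_open[of _ _ _ "{..<0}"]) (use less in \<open>auto simp: flat_def\<close>)
  then show ?thesis using less by (simp add: flat_def)
next
  case equal
  \<comment> \<open>Dividing by \<open>y\<close> multiplies the polynomial by its variable, so the
    difference quotient is again a member of the family.\<close>
  have "((\<lambda>y. flat p y / y) \<longlongrightarrow> 0) (at 0)"
    using flat_0[of "pCons 0 p"] by (rule Lim_transform_eventually) (auto simp: flat_def eventually_at_filter)
  then show ?thesis using equal by (simp add: has_field_derivative_iff flat_def)
next
  case greater
  have "((\<lambda>x. poly p (1 / x) * exp (- 1 / x)) has_real_derivative
      poly ([:0, 0, 1:] * (p - pderiv p)) (1 / x) * exp (- 1 / x)) (at x)"
    using greater by (auto intro!: derivative_eq_intros poly_DERIV[THEN DERIV_chain2] simp: field_simps power2_eq_square)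
  then have "(flat p has_real_derivative poly ([:0, 0, 1:] * (p - pderiv p)) (1 / x) * exp (- 1 / x)) (at x)"
    by (rule has_field_derivative_transform_within_open[of _ _ _ "{0<..}"]) (use greater in \<open>auto simp: flat_def\<close>)
  then show ?thesis using greater by (simp add: flat_def)
qed

lemma times_differentiable_flat: "times_differentiable k (flat p)"
proof (induction k arbitrary: p)
  case 0
  then show ?case using DERIV_flat by (auto simp: differentiable_on_def real_differentiable_def)
next
  case (Suc k)
  show ?case by (rule times_differentiable_SucI[OF DERIV_flat Suc])
qed

section \<open>The smooth step from 0 to 1\<close>

text \<open>The denominator never vanishes, since \<open>x\<close> and \<open>1 - x\<close> cannot
  both be nonpositive. The quotient is written with \<open>inverse\<close> to fit the closure
  lemmas.\<close>

definition smooth_step :: "real \<Rightarrow> real" where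
  "smooth_step x = flat 1 x * inverse (flat 1 x + flat 1 (1 - x))"

lemma flat_1_nonneg: "0 \<le> flat 1 x" by (simp add: flat_def)

lemma flat_1_sum_pos: "0 < flat 1 x + flat 1 (1 - x)" by (auto simp: flat_def intro: add_pos_pos)

lemma times_differentiable_smooth_step: "times_differentiable k smooth_step"
proof -
  have "times_differentiable k (\<lambda>x. 1 * flat 1 (-1 * x + 1))"
    by (intro times_differentiable_affine times_differentiable_flat)
  then have "times_differentiable k (\<lambda>x. flat 1 (1 - x))" by simp
  then show ?thesis
    unfolding smooth_step_def[abs_def] using flat_1_sum_pos
    by (intro times_differentiable_mult times_differentiable_inverse times_differentiable_add times_differentiable_flat)
       (auto simp: less_le)
qed

lemma smooth_step_eq_0: "x \<le> 0 \<Longrightarrow> smooth_step x = 0"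
  by (simp add: smooth_step_def flat_def)

lemma smooth_step_eq_1: "1 \<le> x \<Longrightarrow> smooth_step x = 1"
  by (simp add: smooth_step_def flat_def)

lemma smooth_step_bounds: "0 \<le> smooth_step x" "smooth_step x \<le> 1"
  using flat_1_nonneg[of x] flat_1_nonneg[of "1 - x"] flat_1_sum_pos[of x]
  by (simp_all add: smooth_step_def field_simps)

lemma DERIV_smooth_step: "(smooth_step has_real_derivative deriv smooth_step x) (at x)"
  using times_differentiable_imp_differentiable[OF times_differentiable_smooth_step] 
  by (rule differentiable_on_UNIV_deriv)

lemma continuous_on_deriv_smooth_step: "continuous_on S (deriv smooth_step)"
proof -
  have "deriv smooth_step differentiable_on UNIV"
    using times_differentiable_smooth_step[of 1] by simp
  then show ?thesis
    by (rule continuous_on_subset[OF differentiable_imp_continuous_on]) simp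
qed

section \<open>Weak derivatives of continuous functions\<close>

text \<open>The climb from 0 to 1 takes place on \<open>[c, c + 1 / r]\<close>; as \<open>r\<close>
  grows, the ramps approach the indicator of the open half-line right of \<open>c\<close>.\<close>

definition ramp :: "real \<Rightarrow> real \<Rightarrow> real \<Rightarrow> real" where
  "ramp r c x = smooth_step (r * (x - c))"

lemma times_differentiable_ramp: "times_differentiable k (\<lambda>x. m * ramp r c x)"
proof -
  have "times_differentiable k (\<lambda>x. m * smooth_step (r * x + (- r * c)))"
    by (intro times_differentiable_affine times_differentiable_smooth_step)
  then show ?thesis by (simp add: ramp_def[abs_def] algebra_simps)
qed

definition ramp_deriv :: "real \<Rightarrow> real \<Rightarrow> real \<Rightarrow> real" where
  "ramp_deriv r c x = r * deriv smooth_step (r * (x - c))"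

lemma DERIV_ramp: "(ramp r c has_real_derivative ramp_deriv r c x) (at x)"
proof -
  have "((\<lambda>x. smooth_step (r * x + (- r * c))) has_real_derivative
      deriv smooth_step (r * x + (- r * c)) * r) (at x)"
    by (rule DERIV_affine[OF DERIV_smooth_step])
  then show ?thesis by (simp add: ramp_def[abs_def] ramp_deriv_def algebra_simps)
qed

lemma continuous_on_ramp: "continuous_on S (ramp r c)"
  using DERIV_ramp by (meson DERIV_continuous_on has_field_derivative_at_within)

lemma continuous_on_ramp_deriv: "continuous_on S (ramp_deriv r c)"
  unfolding ramp_deriv_def[abs_def]
  by (intro continuous_intros continuous_on_compose2[OF continuous_on_deriv_smooth_step[of UNIV]]) auto

lemma ramp_eq_0: "0 \<le> r \<Longrightarrow> x \<le> c \<Longrightarrow> ramp r c x = 0"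
  unfolding ramp_def by (intro smooth_step_eq_0 mult_nonneg_nonpos) auto

lemma ramp_eq_1: "0 < r \<Longrightarrow> c + 1 / r \<le> x \<Longrightarrow> ramp r c x = 1"
  unfolding ramp_def by (intro smooth_step_eq_1) (simp add: field_simps)

lemma ramp_bounds: "0 \<le> ramp r c x" "ramp r c x \<le> 1"
  by (simp_all add: ramp_def smooth_step_bounds)

lemma ramp_deriv_eq_0_left:
  assumes "0 \<le> r" "x < c"
  shows "ramp_deriv r c x = 0"
proof -
  have "((\<lambda>x. 0) has_real_derivative 0) (at x)" by simp
  then have "(ramp r c has_real_derivative 0) (at x)"
    by (rule has_field_derivative_transform_within_open[of _ _ _ "{..<c}"])
       (use assms in \<open>auto simp: ramp_eq_0\<close>)
  then show ?thesis using DERIV_ramp DERIV_unique by blast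
qed

lemma ramp_deriv_eq_0_right:
  assumes "0 < r" "c + 1 / r < x"
  shows "ramp_deriv r c x = 0"
proof -
  have "((\<lambda>x. 1) has_real_derivative 0) (at x)" by simp
  then have "(ramp r c has_real_derivative 0) (at x)"
    by (rule has_field_derivative_transform_within_open[of _ _ _ "{c + 1 / r<..}"])
       (use assms in \<open>auto simp: ramp_eq_1\<close>)
  then show ?thesis using DERIV_ramp DERIV_unique by blast
qed

text \<open>One \<open>B\<close> serves all \<open>r\<close> and \<open>c\<close>: the derivative of
  the step is continuous on \<open>[0, 1]\<close> and zero elsewhere, and scaling contributes
  exactly the factor \<open>r\<close>.\<close>

lemma ramp_deriv_bounded:
  obtains B where "0 < B" "\<And>r c x. 0 < r \<Longrightarrow> \<bar>ramp_deriv r c x\<bar> \<le> r * B"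
proof -
  have "bounded (deriv smooth_step ` {0..1})"
    by (intro compact_imp_bounded compact_continuous_image continuous_on_deriv_smooth_step) auto
  then obtain B where B: "0 < B" "\<And>y. y \<in> {0..1} \<Longrightarrow> \<bar>deriv smooth_step y\<bar> \<le> B"
    unfolding bounded_pos by auto
  have "\<bar>deriv smooth_step y\<bar> \<le> B" for y
  proof (cases "y \<in> {0..1}")
    case False
    then have "deriv smooth_step y = 0"
      using ramp_deriv_eq_0_left[of 1 y 0] ramp_deriv_eq_0_right[of 1 0 y]
      by (auto simp: ramp_deriv_def)
    then show ?thesis using B by simp
  qed (use B in auto)
  then show thesis
    using that[of B] B(1) by (auto simp: ramp_deriv_def abs_mult)
qed

text \<open>The ramp derivatives form a one-sided approximate identity at \<open>c\<close>: mass 1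
  on an interval of length \<open>1 / n\<close>. Their height is at most \<open>n * B\<close>, so
  height and width cancel and only the oscillation of \<open>v\<close> near \<open>c\<close>
  remains.\<close>

lemma tendsto_integral_ramp_deriv:
  fixes v :: "real \<Rightarrow> real"
  assumes v: "continuous_on {c..e} v" and "c < e"
  shows "(\<lambda>n. integral {c..e} (\<lambda>x. v x * ramp_deriv (real n) c x)) \<longlonglongrightarrow> v c"
proof -
  obtain B where B: "0 < B" "\<And>r c x. 0 < r \<Longrightarrow> \<bar>ramp_deriv r c x\<bar> \<le> r * B"
    using ramp_deriv_bounded by metis
  show ?thesis
  proof (rule LIMSEQ_I)
    fix \<epsilon> :: real assume "0 < \<epsilon>"
    then have "0 < \<epsilon> / (2 * B)" using B by simp
    moreover have "continuous (at c within {c..e}) v"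
      using v \<open>c < e\<close> by (simp add: continuous_on_eq_continuous_within)
    ultimately obtain \<delta> where \<delta>: "0 < \<delta>"
      "\<And>x. x \<in> {c..e} \<Longrightarrow> \<bar>x - c\<bar> < \<delta> \<Longrightarrow> \<bar>v x - v c\<bar> < \<epsilon> / (2 * B)"
      unfolding continuous_within_eps_delta dist_real_def by metis
    obtain N where N: "0 < N" "1 / real N < min \<delta> (e - c)"
      using \<open>0 < \<delta>\<close> \<open>c < e\<close> ex_inverse_of_nat_less[of "min \<delta> (e - c)"] by (auto simp: divide_inverse)
    show "\<exists>no. \<forall>n\<ge>no. norm (integral {c..e} (\<lambda>x. v x * ramp_deriv (real n) c x) - v c) < \<epsilon>"
    proof (intro exI allI impI)
      fix n assume "N \<le> n"
      then have n: "0 < n" "1 / real n < \<delta>" "1 / real n < e - c"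
        using N by (auto intro: le_less_trans[OF divide_left_mono[of "real N" "real n" 1]])
      let ?e = "c + 1 / real n" and ?g = "ramp_deriv (real n) c"
      have int: "(\<lambda>x. v x * ?g x) integrable_on {c..e}"
        using v by (intro integrable_continuous_real continuous_intros continuous_on_ramp_deriv)
      \<comment> \<open>At \<open>?e\<close> itself the vanishing lemma, which is strict, does not
        apply; that point is discarded as a null set.\<close>
      have "integral {?e..e} (\<lambda>x. v x * ?g x) = integral {?e..e} (\<lambda>x. 0)"
        by (rule integral_spike[of "{?e}"]) (use n in \<open>auto intro!: ramp_deriv_eq_0_right\<close>)
      then have 1: "integral {c..e} (\<lambda>x. v x * ?g x) = integral {c..?e} (\<lambda>x. v x * ?g x)"
        using Henstock_Kurzweil_Integration.integral_combine[of c ?e e, OF _ _ int] n by simp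
      have "(?g has_integral (ramp (real n) c ?e - ramp (real n) c c)) {c..?e}"
        using DERIV_ramp
        by (intro fundamental_theorem_of_calculus)
           (auto simp flip: has_real_derivative_iff_has_vector_derivative intro: has_field_derivative_at_within)
      then have 2: "(?g has_integral 1) {c..?e}"
        using n by (simp add: ramp_eq_0 ramp_eq_1)
      have sub: "continuous_on {c..?e} v" using v by (rule continuous_on_subset) (use n in auto)
      have "integral {c..?e} (\<lambda>x. v x * ?g x) - v c = integral {c..?e} (\<lambda>x. (v x - v c) * ?g x)"
      proof -
        have "integral {c..?e} (\<lambda>x. (v x - v c) * ?g x)
            = integral {c..?e} (\<lambda>x. v x * ?g x) - integral {c..?e} (\<lambda>x. v c * ?g x)"
          unfolding left_diff_distrib using sub
          by (intro integral_diff integrable_continuous_real continuous_intros continuous_on_ramp_deriv)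
        then show ?thesis using integral_unique[OF 2] by simp
      qed
      also have "norm \<dots> \<le> (\<epsilon> / (2 * B) * (real n * B)) * (?e - c)"
      proof (rule integral_bound)
        fix x assume x: "x \<in> {c..?e}"
        then have "\<bar>v x - v c\<bar> < \<epsilon> / (2 * B)" using n by (intro \<delta>) auto
        then show "norm ((v x - v c) * ?g x) \<le> \<epsilon> / (2 * B) * (real n * B)"
          unfolding real_norm_def abs_mult using B n by (intro mult_mono) auto
      qed (use sub in \<open>auto intro!: continuous_intros continuous_on_ramp_deriv\<close>)
      also have "\<dots> = \<epsilon> / 2" using B n by (simp add: field_simps)
      also have "\<dots> < \<epsilon>" using \<open>0 < \<epsilon>\<close> by simp
      finally show "norm (integral {c..e} (\<lambda>x. v x * ?g x) - v c) < \<epsilon>" using 1 by simp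
    qed
  qed
qed

section \<open>Weak derivatives integrate to increments\<close>

text \<open>Left of \<open>c\<close> both ramps are 0, and beyond \<open>e\<close> both have reached
  1, so the support lies in \<open>{c..e}\<close>.\<close>

lemma test_function_ramp_diff:
  assumes "a < c" "c \<le> d" "d < e" "e < b" "0 < r" "d + 1 / r \<le> e"
  shows "test_function a b (\<lambda>x. ramp r c x - ramp r d x)"
proof -
  have "times_differentiable k (\<lambda>x. 1 * ramp r c x + (-1) * ramp r d x)" for k
    by (intro times_differentiable_add times_differentiable_ramp)
  then have "(deriv ^^ k) (\<lambda>x. ramp r c x - ramp r d x) differentiable_on UNIV" for k
    by (intro times_differentiable_imp_funpow_deriv) simp
  moreover have "ramp r c x - ramp r d x = 0" if "x \<notin> {c..e}" for x
  proof (cases "x < c")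
    case True
    then show ?thesis using assms by (simp add: ramp_eq_0)
  next
    case False
    then have "c + 1 / r \<le> x" "d + 1 / r \<le> x" using that assms by auto
    then show ?thesis using assms by (simp add: ramp_eq_1)
  qed
  ultimately show ?thesis
    unfolding test_function_def using assms
    by (intro conjI allI exI[of _ "{c..e}"]) auto
qed

text \<open>Passes from the Lebesgue integrals of the definitions to gauge integrals over a smaller
  set carrying the integrand.\<close>

lemma lebesgue_on_integral_eq_integral_support:
  fixes f :: "real \<Rightarrow> real"
  assumes "f absolutely_integrable_on T" "T \<subseteq> S" "T \<in> sets lebesgue" "S \<in> sets lebesgue"
    and "\<And>x. x \<in> S - T \<Longrightarrow> f x = 0"
  shows "(LINT x|lebesgue_on S. f x) = integral T f"
proof -
  have "(LINT x|lebesgue_on S. f x) = (LINT x|lebesgue. indicator S x *\<^sub>R f x)"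
    using assms by (intro integral_restrict_space) auto
  also have "(\<lambda>x. indicator S x *\<^sub>R f x) = (\<lambda>x. indicator T x *\<^sub>R f x)"
    using assms by (auto simp: indicator_def fun_eq_iff)
  also have "(LINT x|lebesgue. indicator T x *\<^sub>R f x) = integral T f"
    using set_lebesgue_integral_eq_integral(2)[OF assms(1)] by (simp add: set_lebesgue_integral_def)
  finally show ?thesis .
qed

lemma absolutely_integrable_continuous_mult:
  fixes w h :: "real \<Rightarrow> real"
  assumes w: "w absolutely_integrable_on {c..e}" and h: "continuous_on {c..e} h"
  shows "(\<lambda>x. w x * h x) absolutely_integrable_on {c..e}"
proof -
  have "(\<lambda>x. h x * w x) absolutely_integrable_on {c..e}"
  proof (rule absolutely_integrable_bounded_measurable_product_real)
    show "h \<in> borel_measurable (lebesgue_on {c..e})"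
      using h by (intro continuous_imp_measurable_on_sets_lebesgue) auto
    show "bounded (h ` {c..e})" 
      by (intro compact_imp_bounded compact_continuous_image h) auto
  qed (use w in auto)
  then show ?thesis by (simp add: mult.commute)
qed

text \<open>Test with \<open>\<psi> n\<close>, the difference of ramps at \<open>c\<close> and
  \<open>d\<close>. The side with \<open>v\<close> tends to \<open>v c - v d\<close> by the
  approximate identity; on the side with \<open>w\<close>, \<open>\<psi> n\<close> tends to the
  indicator of \<open>(c, d]\<close> and dominated convergence applies.\<close>

lemma integral_weak_deriv:
  assumes w: "has_weak_deriv a b v w" and v: "continuous_on {a<..<b} v"
    and cd: "a < c" "c < d" "d < b"
  shows "integral {c..d} w = v d - v c"
proof -
  \<comment> \<open>Room to the right of \<open>d\<close>, still inside the domain, for the second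
    ramp to reach 1.\<close>
  define e where "e = (d + b) / 2"
  have e: "d < e" "e < b" using cd by (auto simp: e_def)
  define \<psi> where "\<psi> = (\<lambda>n x. ramp (real n) c x - ramp (real n) d x)"
  define \<psi>' where "\<psi>' = (\<lambda>n x. ramp_deriv (real n) c x - ramp_deriv (real n) d x)"
  have wi: "w absolutely_integrable_on {c..e}"
  proof -
    have "compact {c..e}" "{c..e} \<subseteq> {a<..<b}" using cd e by auto
    then show ?thesis using w unfolding has_weak_deriv_def loc_integrable_def by blast
  qed
  have v': "continuous_on {c..e} v" using v by (rule continuous_on_subset) (use cd e in auto)
  have "\<forall>\<^sub>F n in sequentially. 1 / real n < e - d"
    using e by real_asymp
  then have ev: "\<forall>\<^sub>F n in sequentially. 0 < n \<and> d + 1 / real n \<le> e"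
    using eventually_gt_at_top[of 0] by eventually_elim auto
  have eq: "integral {c..e} (\<lambda>x. v x * \<psi>' n x) = - integral {c..e} (\<lambda>x. w x * \<psi> n x)"
    if "0 < n \<and> d + 1 / real n \<le> e" for n
  proof -
    have test: "test_function a b (\<psi> n)"
      unfolding \<psi>_def using that cd e by (intro test_function_ramp_diff[of _ _ _ e]) auto
    have D: "(\<psi> n has_real_derivative \<psi>' n x) (at x)" for x
      unfolding \<psi>_def \<psi>'_def by (intro DERIV_diff DERIV_ramp)
    then have deriv: "deriv (\<psi> n) = \<psi>' n" by (auto intro!: DERIV_imp_deriv)
    have supp: "\<psi> n x = 0 \<and> \<psi>' n x = 0" if "x \<notin> {c..e}" for x
    proof (cases "x < c")
      case True
      then show ?thesis using cd by (simp add: \<psi>_def \<psi>'_def ramp_eq_0 ramp_deriv_eq_0_left)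
    next
      case False
      with that \<open>0 < n \<and> d + 1 / real n \<le> e\<close> have "d + 1 / real n < x" by auto
      then show ?thesis using \<open>0 < n \<and> _\<close> cd
        by (simp add: \<psi>_def \<psi>'_def ramp_eq_1 ramp_deriv_eq_0_right)
    qed
    have "(LINT x|lebesgue_on {a<..<b}. v x * \<psi>' n x) = integral {c..e} (\<lambda>x. v x * \<psi>' n x)"
      using cd e supp v'
      by (intro lebesgue_on_integral_eq_integral_support absolutely_integrable_continuous_real)
         (auto simp: \<psi>'_def intro!: continuous_intros continuous_on_ramp_deriv)
    moreover have "(LINT x|lebesgue_on {a<..<b}. w x * \<psi> n x) = integral {c..e} (\<lambda>x. w x * \<psi> n x)"
      using cd e supp wi
      by (intro lebesgue_on_integral_eq_integral_support absolutely_integrable_continuous_mult)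
         (auto simp: \<psi>_def intro!: continuous_intros continuous_on_ramp)
    ultimately show ?thesis
      using w test deriv by (auto simp: has_weak_deriv_def)
  qed
  \<comment> \<open>The kernel at \<open>d\<close> vanishes left of \<open>d\<close>, so its
    integral may start at \<open>d\<close>, as the limit lemma requires.\<close>
  have split: "integral {c..e} (\<lambda>x. v x * \<psi>' n x) =
      integral {c..e} (\<lambda>x. v x * ramp_deriv (real n) c x)
      - integral {d..e} (\<lambda>x. v x * ramp_deriv (real n) d x)" for n
  proof -
    have int: "(\<lambda>x. v x * ramp_deriv (real n) y x) integrable_on {c..e}" for y
      using v' by (intro integrable_continuous_real continuous_intros continuous_on_ramp_deriv)
    have "integral {c..d} (\<lambda>x. v x * ramp_deriv (real n) d x) = integral {c..d} (\<lambda>x. 0)"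
      by (rule integral_spike[of "{d}"]) (auto intro!: ramp_deriv_eq_0_left)
    then have "integral {c..e} (\<lambda>x. v x * ramp_deriv (real n) d x)
        = integral {d..e} (\<lambda>x. v x * ramp_deriv (real n) d x)"
      using Henstock_Kurzweil_Integration.integral_combine[of c d e, OF _ _ int[of d]] cd e by simp
    then show ?thesis
      using integral_diff[OF int int, of c d] by (simp add: \<psi>'_def right_diff_distrib)
  qed
  have lim_v: "(\<lambda>n. integral {c..e} (\<lambda>x. v x * \<psi>' n x)) \<longlonglongrightarrow> v c - v d"
    unfolding split using cd e v'
    by (intro tendsto_diff tendsto_integral_ramp_deriv)
       (auto intro: continuous_on_subset)
  have lim_w: "(\<lambda>n. - integral {c..e} (\<lambda>x. w x * \<psi> n x)) \<longlonglongrightarrow> - integral {c..d} w"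
  proof -
    \<comment> \<open>At \<open>x = y\<close> the ramp is 0, hence the open half-line.\<close>
    have lim: "(\<lambda>n. ramp (real n) y x) \<longlonglongrightarrow> indicator {y<..} x" for y x
    proof (cases "y < x")
      case True
      then have "\<forall>\<^sub>F n in sequentially. 1 / real n < x - y" by real_asymp
      then have "\<forall>\<^sub>F n in sequentially. 1 = ramp (real n) y x"
        using eventually_gt_at_top[of 0] by eventually_elim (auto simp: ramp_eq_1)
      then show ?thesis using True by (auto intro: Lim_transform_eventually[OF tendsto_const])
    qed (simp add: ramp_eq_0)
    have "(\<lambda>n. integral {c..e} (\<lambda>x. w x * \<psi> n x)) \<longlonglongrightarrow>
        integral {c..e} (\<lambda>x. w x * (indicator {c<..} x - indicator {d<..} x))"
    proof (rule dominated_convergence(2))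
      show "(\<lambda>x. w x * \<psi> n x) integrable_on {c..e}" for n
        unfolding \<psi>_def
        by (intro set_lebesgue_integral_eq_integral(1) absolutely_integrable_continuous_mult wi
              continuous_intros continuous_on_ramp)
      show "(\<lambda>x. \<bar>w x\<bar>) integrable_on {c..e}"
        using wi by (auto simp: absolutely_integrable_on_def)
      show "norm (w x * \<psi> n x) \<le> \<bar>w x\<bar>" for n x
      proof -
        have "\<bar>\<psi> n x\<bar> \<le> 1"
          using ramp_bounds[of "real n" c x] ramp_bounds[of "real n" d x] by (auto simp: \<psi>_def)
        then show ?thesis by (simp add: abs_mult mult_left_le)
      qed
      show "(\<lambda>n. w x * \<psi> n x) \<longlonglongrightarrow> w x * (indicator {c<..} x - indicator {d<..} x)" for x
        unfolding \<psi>_def by (intro tendsto_intros lim)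
    qed
    also have "integral {c..e} (\<lambda>x. w x * (indicator {c<..} x - indicator {d<..} x))
        = integral {c..e} (\<lambda>x. if x \<in> {c..d} then w x else 0)"
      by (rule integral_spike[of "{c}"]) (use cd in \<open>auto simp: indicator_def\<close>)
    also have "\<dots> = integral {c..d} w"
      using Henstock_Kurzweil_Integration.integral_restrict_Int[of "{c..e}" "{c..d}" w] e by simp
    finally show ?thesis by (rule tendsto_minus)
  qed
  have "\<forall>\<^sub>F n in sequentially.
      integral {c..e} (\<lambda>x. v x * \<psi>' n x) = - integral {c..e} (\<lambda>x. w x * \<psi> n x)"
    using ev by (rule eventually_mono) (rule eq)
  then have "v c - v d = - integral {c..d} w"
    by (rule LIMSEQ_unique[OF Lim_transform_eventually[OF lim_v] lim_w])
  then show ?thesis by simp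
qed

section \<open>Uniqueness of weak derivatives almost everywhere\<close>

text \<open>As \<open>ennreal\<close> sends negative numbers to 0, \<open>?M\<close> and
  \<open>?N\<close> have the positive and the negative part of \<open>g\<close> as densities. They
  are finite and agree on all rays, hence are equal; so the two parts agree almost everywhere, which
  forces \<open>g = 0\<close>.\<close>

lemma AE_lborel_eq_0_if_integral_greaterThan_eq_0:
  fixes g :: "real \<Rightarrow> real"
  assumes g: "integrable lborel g"
    and 0: "\<And>t. (LINT x|lborel. indicator {t<..} x * g x) = 0"
  shows "AE x in lborel. g x = 0"
proof -
  let ?M = "density lborel (\<lambda>x. ennreal (g x))" and ?N = "density lborel (\<lambda>x. ennreal (- g x))"
  have [measurable]: "g \<in> borel_measurable borel" using g by simp
  have "(\<integral>\<^sup>+x. ennreal (norm (g x)) \<partial>lborel) < \<infinity>"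
    using g by (simp add: integrable_iff_bounded)
  \<comment> \<open>The sign \<open>s\<close> treats both densities at once.\<close>
  moreover have le: "(\<integral>\<^sup>+x. ennreal (s * g x) * indicator A x \<partial>lborel) \<le> (\<integral>\<^sup>+x. ennreal (norm (g x)) \<partial>lborel)"
    if "s \<in> {1, -1}" for s A
    using that by (intro nn_integral_mono) (auto simp: indicator_def intro: ennreal_leI)
  ultimately have fin: "(\<integral>\<^sup>+x. ennreal (s * g x) * indicator A x \<partial>lborel) < \<infinity>" if "s \<in> {1, -1}" for s A
    using that le_less_trans by blast
  have "?M = ?N"
  proof (rule measure_eqI_lessThan)
    show "emeasure ?M {t<..} < \<infinity>" for t
      using fin[of 1 "{t<..}"] by (simp add: emeasure_density)
    show "emeasure ?M {t<..} = emeasure ?N {t<..}" for t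
    proof -
      have P: "(\<integral>\<^sup>+x. ennreal (indicator {t<..} x * g x) \<partial>lborel) = emeasure ?M {t<..}"
        by (subst emeasure_density) (auto intro!: nn_integral_cong simp: indicator_def)
      have N: "(\<integral>\<^sup>+x. ennreal (- (indicator {t<..} x * g x)) \<partial>lborel) = emeasure ?N {t<..}"
        by (subst emeasure_density) (auto intro!: nn_integral_cong simp: indicator_def)
      have "integrable lborel (\<lambda>x. indicator {t<..} x * g x)"
        using integrable_mult_indicator[OF _ g, of "{t<..}"] by simp
      then have "enn2real (emeasure ?M {t<..}) = enn2real (emeasure ?N {t<..})"
        using 0[of t] by (simp add: real_lebesgue_integral_def P N)
      moreover have "emeasure ?M {t<..} < top" "emeasure ?N {t<..} < top"
        using fin[of 1 "{t<..}"] fin[of "-1" "{t<..}"] by (simp_all add: emeasure_density)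
      ultimately show ?thesis
        by (metis ennreal_enn2real)
    qed
  qed auto
  then have "AE x in lborel. ennreal (g x) = ennreal (- g x)"
    using fin[of 1 UNIV] by (subst (asm) finite_density_unique) (auto simp: less_top)
  then show ?thesis
    by eventually_elim (metis ennreal_eq_zero_iff ennreal_neg le_cases neg_le_0_iff_le neg_0_le_iff_le order_antisym)
qed

text \<open>Extend \<open>h\<close> by zero, replace it by a Borel function equal almost everywhere,
  and apply the ray criterion: each ray cuts \<open>{c..d}\<close> in a final segment, up to a
  point.\<close>

lemma AE_eq_0_if_integral_eq_0:
  fixes h :: "real \<Rightarrow> real"
  assumes h: "h absolutely_integrable_on {c..d}"
    and 0: "\<And>x. c \<le> x \<Longrightarrow> x < d \<Longrightarrow> integral {x..d} h = 0"
  shows "AE x in lebesgue. x \<in> {c..d} \<longrightarrow> h x = 0"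
proof -
  define F where "F = (\<lambda>x. indicator {c..d} x * h x)"
  have F: "integrable lebesgue F" using h by (simp add: F_def set_integrable_def)
  then have "F \<in> borel_measurable lebesgue" by simp
  then obtain g where g[measurable]: "g \<in> borel_measurable lborel" and eq: "AE x in lborel. F x = g x"
    using completion_ex_borel_measurable_real by blast
  have eq': "AE x in lebesgue. F x = g x" using eq by (rule AE_completion)
  have gl: "g \<in> borel_measurable lebesgue" using g by (rule measurable_completion)
  have "integrable lebesgue g"
    using F integrable_cong_AE[OF _ gl eq'] by simp
  then have gi: "integrable lborel g" by (simp add: integrable_completion)
  have "AE x in lborel. g x = 0"
  proof (rule AE_lborel_eq_0_if_integral_greaterThan_eq_0[OF gi])
    fix t :: real
    have "(LINT x|lborel. indicator {t<..} x * g x) = (LINT x|lebesgue. indicator {t<..} x * g x)"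
      by (rule integral_completion[symmetric]) measurable
    also have "\<dots> = (LINT x|lebesgue. indicator {t<..} x * F x)"
    proof (rule integral_cong_AE)
      show "(\<lambda>x. indicator {t<..} x * g x) \<in> borel_measurable lebesgue"
        by (rule measurable_completion) measurable
      have "indicat_real {t<..} \<in> borel_measurable lebesgue"
        by (rule measurable_completion) measurable
      then show "(\<lambda>x. indicator {t<..} x * F x) \<in> borel_measurable lebesgue"
        using F by (intro borel_measurable_times) auto
    qed (use eq' in auto)
    also have "\<dots> = (LINT x:{max c t..d}|lebesgue. h x)"
      unfolding set_lebesgue_integral_def
    proof (rule integral_cong_AE)
      have "indicat_real {t<..} \<in> borel_measurable lebesgue"
        by (rule measurable_completion) measurable
      then show "(\<lambda>x. indicator {t<..} x * F x) \<in> borel_measurable lebesgue"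
        using F by (intro borel_measurable_times) auto
      have "h absolutely_integrable_on {max c t..d}"
        using h by (rule absolutely_integrable_on_subinterval) auto
      then show "(\<lambda>x. indicat_real {max c t..d} x *\<^sub>R h x) \<in> borel_measurable lebesgue"
        by (auto simp: set_integrable_def)
      have "AE x in lebesgue. x \<noteq> t" by (rule AE_completion[OF AE_lborel_singleton])
      then show "AE x in lebesgue. indicator {t<..} x * F x = indicat_real {max c t..d} x *\<^sub>R h x"
        by eventually_elim (auto simp: F_def indicator_def)
    qed
    also have "\<dots> = integral {max c t..d} h"
      using h by (intro set_lebesgue_integral_eq_integral(2)) (rule absolutely_integrable_on_subinterval, auto)
    also have "\<dots> = 0"
      \<comment> \<open>If the ray starts at or beyond \<open>d\<close>, the segment is empty or a
        single point.\<close>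
      using 0[of "max c t"] negligible_interval(1)[of "max c t" d]
      by (cases "max c t < d") (auto intro!: integral_negligible)
    finally show "(LINT x|lborel. indicator {t<..} x * g x) = 0" .
  qed
  then have "AE x in lebesgue. g x = 0" by (rule AE_completion)
  then show ?thesis using eq' by eventually_elim (auto simp: F_def)
qed

text \<open>Both candidates integrate to the same increments of \<open>v\<close>, so they agree
  almost everywhere on each compact subinterval.\<close>

lemma has_weak_deriv_unique_AE:
  assumes w: "has_weak_deriv a b v w" "has_weak_deriv a b v w'" and v: "continuous_on {a<..<b} v"
  shows "AE x in lebesgue_on {a<..<b}. w x = w' x"
proof -
  have "AE x in lebesgue. x \<in> {c..d} \<longrightarrow> w x - w' x = 0" if "a < c" "d < b" for c d
  proof (rule AE_eq_0_if_integral_eq_0)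
    have K: "compact {c..d}" "{c..d} \<subseteq> {a<..<b}" using that by auto
    then have int: "w absolutely_integrable_on {c..d}" "w' absolutely_integrable_on {c..d}"
      using w unfolding has_weak_deriv_def loc_integrable_def by blast+
    then show "(\<lambda>x. w x - w' x) absolutely_integrable_on {c..d}" by (rule set_integral_diff)
    show "integral {x..d} (\<lambda>x. w x - w' x) = 0" if "c \<le> x" "x < d" for x
    proof -
      have "w integrable_on {x..d}" "w' integrable_on {x..d}"
        using int that by (auto intro!: set_lebesgue_integral_eq_integral(1)
             intro: absolutely_integrable_on_subinterval)
      then show ?thesis
        using integral_weak_deriv[OF w(1) v, of x d] integral_weak_deriv[OF w(2) v, of x d]
          that \<open>a < c\<close> \<open>d < b\<close> by (simp add: integral_diff)
    qed
  qed
  \<comment> \<open>Rational endpoints leave countably many intervals, so their exceptional sets can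
    be united.\<close>
  then have "AE x in lebesgue. \<forall>p \<in> {p \<in> \<rat> \<times> \<rat>. a < fst p \<and> snd p < b}. x \<in> {fst p..snd p} \<longrightarrow> w x - w' x = 0"
    by (subst AE_ball_countable) (auto intro: countable_subset[OF _ countable_SIGMA[OF countable_rat countable_rat]])
  then have "AE x in lebesgue. x \<in> {a<..<b} \<longrightarrow> w x = w' x"
  proof eventually_elim
    case (elim x)
    show ?case
    proof
      assume x: "x \<in> {a<..<b}"
      obtain c where "c \<in> \<rat>" "a < c" "c < x" using Rats_dense_in_real[of a x] x by auto
      moreover obtain d where "d \<in> \<rat>" "x < d" "d < b" using Rats_dense_in_real[of x b] x by auto
      ultimately have "w x - w' x = 0" using bspec[OF elim, of "(c, d)"] by auto
      then show "w x = w' x" by simp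
    qed
  qed
  then show ?thesis by (simp add: AE_restrict_space_iff)
qed

section \<open>Classical and linear rules for weak derivatives\<close>

text \<open>On the compact set \<open>K\<close> the factor \<open>h\<close> is bounded and
  \<open>v\<close> integrable; outside it the product is zero.\<close>

lemma integrable_loc_integrable_mult:
  fixes h :: "real \<Rightarrow> real"
  assumes v: "loc_integrable a b v" and h: "continuous_on UNIV h"
    and K: "compact K" "K \<subseteq> {a<..<b}" "\<And>x. x \<notin> K \<Longrightarrow> h x = 0"
  shows "integrable (lebesgue_on {a<..<b}) (\<lambda>x. v x * h x)"
proof -
  have Kl: "K \<in> sets lebesgue" using K(1) by (simp add: lmeasurable_compact fmeasurableD)
  have "(\<lambda>x. h x * v x) absolutely_integrable_on K"
  proof (rule absolutely_integrable_bounded_measurable_product_real)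
    show "h \<in> borel_measurable (lebesgue_on K)"
      using h Kl by (intro continuous_imp_measurable_on_sets_lebesgue) (auto intro: continuous_on_subset)
    show "bounded (h ` K)"
      using h K(1) by (intro compact_imp_bounded compact_continuous_image) (auto intro: continuous_on_subset)
  qed (use v K Kl in \<open>auto simp: loc_integrable_def\<close>)
  then have "integrable lebesgue (\<lambda>x. indicat_real K x *\<^sub>R (h x * v x))"
    by (simp add: set_integrable_def)
  moreover have "(\<lambda>x. indicat_real K x *\<^sub>R (h x * v x)) = (\<lambda>x. indicat_real {a<..<b} x *\<^sub>R (v x * h x))"
    using K by (auto simp: indicator_def fun_eq_iff)
  ultimately show ?thesis
    by (subst integrable_restrict_space) auto
qed

lemma test_function_props:
  assumes "test_function a b \<psi>"
  obtains K where "compact K" "K \<subseteq> {a<..<b}" "\<And>x. x \<notin> K \<Longrightarrow> \<psi> x = 0" "\<And>x. x \<notin> K \<Longrightarrow> deriv \<psi> x = 0"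
    "continuous_on UNIV \<psi>" "continuous_on UNIV (deriv \<psi>)"
    "\<And>x. (\<psi> has_real_derivative deriv \<psi> x) (at x)"
proof -
  obtain K where K: "compact K" "K \<subseteq> {a<..<b}" "\<And>x. x \<notin> K \<Longrightarrow> \<psi> x = 0"
    and d: "(deriv ^^ k) \<psi> differentiable_on UNIV" for k
    using assms unfolding test_function_def by blast
  have D: "(\<psi> has_real_derivative deriv \<psi> x) (at x)" for x
    using d[of 0] by (intro differentiable_on_UNIV_deriv) simp
  have "deriv \<psi> x = 0" if "x \<notin> K" for x
  proof -
    have "((\<lambda>x. 0) has_real_derivative 0) (at x)" by simp
    then have "(\<psi> has_real_derivative 0) (at x)"
      by (rule has_field_derivative_transform_within_open[of _ _ _ "- K"])
         (use that K in \<open>auto simp: compact_imp_closed\<close>)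
    then show ?thesis using D DERIV_unique by blast
  qed
  moreover have "continuous_on UNIV \<psi>" "continuous_on UNIV (deriv \<psi>)"
    using d[of 0] d[of 1] by (auto intro: differentiable_imp_continuous_on)
  ultimately show thesis using that K D by blast
qed

lemma loc_integrable_continuous:
  assumes "continuous_on UNIV p"
  shows "loc_integrable a b p"
  unfolding loc_integrable_def
proof safe
  fix K :: "real set" assume K: "compact K"
  then have "K \<in> lmeasurable" by (rule lmeasurable_compact)
  have "(\<lambda>x. p x * 1) absolutely_integrable_on K"
  proof (rule absolutely_integrable_bounded_measurable_product_real)
    show "K \<in> sets lebesgue" using \<open>K \<in> lmeasurable\<close> by (rule fmeasurableD)
    then show "p \<in> borel_measurable (lebesgue_on K)"
      using assms by (intro continuous_imp_measurable_on_sets_lebesgue) (auto intro: continuous_on_subset)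
    show "bounded (p ` K)"
      using assms K by (intro compact_imp_bounded compact_continuous_image) (auto intro: continuous_on_subset)
    show "(\<lambda>x. 1::real) absolutely_integrable_on K"
      using \<open>K \<in> lmeasurable\<close> by (rule absolutely_integrable_on_const)
  qed
  then show "p absolutely_integrable_on K" by simp
qed

text \<open>Integration by parts: the derivative of \<open>p * \<psi>\<close> integrates to zero
  because \<open>\<psi>\<close> vanishes at both endpoints. It serves for the identity and for
  constants.\<close>

lemma has_weak_deriv_classical:
  assumes D: "\<And>x. (p has_real_derivative p' x) (at x)" and p': "continuous_on UNIV p'"
  shows "has_weak_deriv a b p p'"
proof -
  have p: "continuous_on UNIV p" using D by (meson DERIV_continuous_on has_field_derivative_at_within)
  have "(LINT x|lebesgue_on {a<..<b}. p x * deriv \<psi> x) = - (LINT x|lebesgue_on {a<..<b}. p' x * \<psi> x)"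
    if t: "test_function a b \<psi>" for \<psi>
  proof (cases "a \<le> b")
    case True
    obtain K where K: "compact K" "K \<subseteq> {a<..<b}" "\<And>x. x \<notin> K \<Longrightarrow> \<psi> x = 0" "\<And>x. x \<notin> K \<Longrightarrow> deriv \<psi> x = 0"
      and c: "continuous_on UNIV \<psi>" "continuous_on UNIV (deriv \<psi>)"
      and D\<psi>: "\<And>x. (\<psi> has_real_derivative deriv \<psi> x) (at x)"
      using test_function_props[OF t] by metis
    have int: "integrable (lebesgue_on {a<..<b}) (\<lambda>x. p x * deriv \<psi> x)"
         "integrable (lebesgue_on {a<..<b}) (\<lambda>x. p' x * \<psi> x)"
      using K c p p' by (auto intro!: integrable_loc_integrable_mult loc_integrable_continuous)
    have "((\<lambda>x. p x * deriv \<psi> x + p' x * \<psi> x) has_integral (p b * \<psi> b - p a * \<psi> a)) {a..b}"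
    proof (rule fundamental_theorem_of_calculus[OF True])
      fix x
      have "((\<lambda>x. p x * \<psi> x) has_real_derivative p x * deriv \<psi> x + p' x * \<psi> x) (at x)"
        using DERIV_mult[OF D D\<psi>, of x] by (simp add: add.commute mult.commute)
      then show "((\<lambda>x. p x * \<psi> x) has_vector_derivative p x * deriv \<psi> x + p' x * \<psi> x) (at x within {a..b})"
        by (simp add: has_field_derivative_at_within flip: has_real_derivative_iff_has_vector_derivative)
    qed
    moreover have "\<psi> a = 0" "\<psi> b = 0" using K(2) by (auto intro!: K(3))
    ultimately have "integral {a<..<b} (\<lambda>x. p x * deriv \<psi> x + p' x * \<psi> x) = 0"
      by (simp add: integral_unique flip: integral_open_interval_real)
    then have "(LINT x|lebesgue_on {a<..<b}. p x * deriv \<psi> x + p' x * \<psi> x) = 0"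
      using int by (subst lebesgue_integral_eq_integral) auto
    then show ?thesis using int by simp
  qed simp
  then show ?thesis
    using p p' by (simp add: has_weak_deriv_def loc_integrable_continuous)
qed

text \<open>Shaped for the upwind map: \<open>p\<close> is the identity, \<open>v\<close> the
  velocity and \<open>k\<close> the time step.\<close>

lemma has_weak_deriv_diff_cmult:
  assumes "has_weak_deriv a b p p'" "has_weak_deriv a b v w"
  shows "has_weak_deriv a b (\<lambda>x. p x - v x * k) (\<lambda>x. p' x - w x * k)"
proof -
  have "loc_integrable a b (\<lambda>x. f x - g x * k)" if "loc_integrable a b f" "loc_integrable a b g" for f g
    using that unfolding loc_integrable_def by (auto intro!: set_integral_diff set_integrable_mult_left)
  moreover have "(LINT x|lebesgue_on {a<..<b}. (p x - v x * k) * deriv \<psi> x) =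
        - (LINT x|lebesgue_on {a<..<b}. (p' x - w x * k) * \<psi> x)" if t: "test_function a b \<psi>" for \<psi>
  proof -
    obtain K where K: "compact K" "K \<subseteq> {a<..<b}" "\<And>x. x \<notin> K \<Longrightarrow> \<psi> x = 0" "\<And>x. x \<notin> K \<Longrightarrow> deriv \<psi> x = 0"
      "continuous_on UNIV \<psi>" "continuous_on UNIV (deriv \<psi>)"
      using test_function_props[OF t] by metis
    have lin: "(LINT x|lebesgue_on {a<..<b}. (f x - g x * k) * h x) =
        (LINT x|lebesgue_on {a<..<b}. f x * h x) - k * (LINT x|lebesgue_on {a<..<b}. g x * h x)"
      if "loc_integrable a b f" "loc_integrable a b g" "h = \<psi> \<or> h = deriv \<psi>" for f g h
    proof -
      have int: "integrable (lebesgue_on {a<..<b}) (\<lambda>x. f x * h x)" "integrable (lebesgue_on {a<..<b}) (\<lambda>x. g x * h x)"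
        using that K by (auto intro!: integrable_loc_integrable_mult)
      have "(LINT x|lebesgue_on {a<..<b}. (f x - g x * k) * h x) =
        (LINT x|lebesgue_on {a<..<b}. f x * h x - k * (g x * h x))"
        by (simp add: algebra_simps)
      then show ?thesis using int by simp
    qed
    show ?thesis
      using assms t by (simp add: lin has_weak_deriv_def)
  qed
  ultimately show ?thesis using assms by (auto simp: has_weak_deriv_def)
qed

section \<open>The change of variables under the upwind map\<close>

text \<open>Freezing \<open>\<phi> \<circ> X\<close> at its value at \<open>y\<close> turns the
  increments of both \<open>G \<circ> X\<close> and \<open>Q\<close> into the same multiple of the
  increment of \<open>X\<close>, with errors of smaller order than \<open>z - y\<close>.
  \<open>X_eq\<close> is given only inside \<open>(a, b)\<close>; continuity reaches the
  endpoints.\<close>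

lemma integral_compose_indefinite_integral:
  fixes X \<gamma> \<phi> :: "real \<Rightarrow> real"
  assumes "a < b" and X: "continuous_on {a..b} X" and \<gamma>: "\<gamma> absolutely_integrable_on {a..b}"
    and M: "\<And>x. \<bar>\<gamma> x\<bar> \<le> M"
    and X_eq: "\<And>c d. a < c \<Longrightarrow> c < d \<Longrightarrow> d < b \<Longrightarrow> integral {c..d} \<gamma> = X d - X c"
    and XI: "X ` {a..b} \<subseteq> {p..q}" and \<phi>: "continuous_on {p..q} \<phi>"
  shows "integral {a..b} (\<lambda>x. \<phi> (X x) * \<gamma> x) = integral {p..X b} \<phi> - integral {p..X a} \<phi>"
proof -
  have "0 \<le> M" using M[of 0] by simp
  have \<phi>X: "continuous_on {a..b} (\<lambda>x. \<phi> (X x))"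
    using XI by (intro continuous_on_compose2[OF \<phi> X]) auto
  have int: "(\<lambda>x. \<phi> (X x) * \<gamma> x) integrable_on {a..b}"
    using absolutely_integrable_continuous_mult[OF \<gamma> \<phi>X]
    by (intro set_lebesgue_integral_eq_integral(1)) (simp add: mult.commute)
  define G where "G = (\<lambda>y. integral {p..y} \<phi>)"
  define Q where "Q = (\<lambda>y. integral {a..y} (\<lambda>x. \<phi> (X x) * \<gamma> x))"
  have Q_est: "\<bar>Q d - Q c - k * (X d - X c)\<bar> \<le> \<eta> * M * (d - c)"
    if cd: "a < c" "c < d" "d < b" and k: "\<And>x. x \<in> {c..d} \<Longrightarrow> \<bar>\<phi> (X x) - k\<bar> \<le> \<eta>" for c d k \<eta>
  proof -
    have sub: "{c..d} \<subseteq> {a..b}" using cd by auto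
    have "integral {a..c} (\<lambda>x. \<phi> (X x) * \<gamma> x) + integral {c..d} (\<lambda>x. \<phi> (X x) * \<gamma> x) = Q d"
      unfolding Q_def using cd
      by (intro Henstock_Kurzweil_Integration.integral_combine integrable_on_subinterval[OF int]) auto
    then have "Q d - Q c = integral {c..d} (\<lambda>x. \<phi> (X x) * \<gamma> x)" by (simp add: Q_def)
    moreover have i1: "(\<lambda>x. \<phi> (X x) * \<gamma> x) integrable_on {c..d}"
      using int sub by (rule integrable_on_subinterval)
    have i2: "\<gamma> integrable_on {c..d}"
      using \<gamma> sub by (meson integrable_on_subinterval set_lebesgue_integral_eq_integral(1))
    have "integral {c..d} (\<lambda>x. \<phi> (X x) * \<gamma> x - k * \<gamma> x)
        = integral {c..d} (\<lambda>x. \<phi> (X x) * \<gamma> x) - k * (X d - X c)"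
      using i1 i2 X_eq[OF cd] by (subst integral_diff) (auto intro: integrable_on_mult_right)
    moreover have "norm (integral {c..d} (\<lambda>x. \<phi> (X x) * \<gamma> x - k * \<gamma> x)) \<le> integral {c..d} (\<lambda>x. \<eta> * M)"
    proof (rule integral_norm_bound_integral)
      show "(\<lambda>x. \<phi> (X x) * \<gamma> x - k * \<gamma> x) integrable_on {c..d}"
        using i1 i2 by (intro integrable_diff integrable_on_mult_right)
      fix x assume x: "x \<in> {c..d}"
      have "norm ((\<phi> (X x) - k) * \<gamma> x) \<le> \<eta> * M"
        unfolding real_norm_def abs_mult using k[OF x] M[of x] by (intro mult_mono) auto
      then show "norm (\<phi> (X x) * \<gamma> x - k * \<gamma> x) \<le> \<eta> * M" by (simp add: left_diff_distrib)
    qed auto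
    ultimately show ?thesis using cd by (simp add: mult_ac)
  qed
  have X_lip: "\<bar>X d - X c\<bar> \<le> M * (d - c)" if cd: "a < c" "c < d" "d < b" for c d
  proof -
    have "\<gamma> integrable_on {c..d}"
      using \<gamma> cd by (intro integrable_on_subinterval[OF set_lebesgue_integral_eq_integral(1)[OF \<gamma>]]) auto
    then have "norm (integral {c..d} \<gamma>) \<le> integral {c..d} (\<lambda>x. M)"
      using M by (intro integral_norm_bound_integral) auto
    then show ?thesis using X_eq[OF cd] cd by (simp add: mult.commute)
  qed
  have G_cont: "continuous_on {p..q} G"
    unfolding G_def using \<phi> by (intro indefinite_integral_continuous_1 integrable_continuous_real)
  have "G (X b) - Q b = G (X a) - Q a"
  proof (rule DERIV_isconst_end[OF \<open>a < b\<close>])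
    show "continuous_on {a..b} (\<lambda>y. G (X y) - Q y)"
      unfolding Q_def using XI
      by (intro continuous_intros continuous_on_compose2[OF G_cont X] indefinite_integral_continuous_1 int) auto
    fix y assume y: "a < y" "y < b"
    show "((\<lambda>y. G (X y) - Q y) has_real_derivative 0) (at y)"
      unfolding has_field_derivative_def has_derivative_at_alt
    proof (intro conjI allI impI)
      fix e :: real assume "0 < e"
      \<comment> \<open>Two errors of size \<open>\<eta> * M * \<bar>z - y\<bar>\<close> must fit
        into \<open>e * \<bar>z - y\<bar>\<close>; \<open>M + 1\<close> keeps the denominator
        positive when \<open>M = 0\<close>.\<close>
      define \<eta> where "\<eta> = e / (2 * (M + 1))"
      have \<eta>: "0 < \<eta>" "2 * (\<eta> * M) \<le> e"
        using \<open>0 < e\<close> \<open>0 \<le> M\<close> by (auto simp: \<eta>_def field_simps)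
      have Xy: "X y \<in> {p..q}" using XI y by (intro subsetD[OF XI] imageI) auto
      \<comment> \<open>\<open>X y\<close> may be an endpoint of \<open>{p..q}\<close>, so the
        derivative is taken within that interval.\<close>
      have "(G has_real_derivative \<phi> (X y)) (at (X y) within {p..q})"
        unfolding G_def by (rule integral_has_real_derivative[OF \<phi> Xy])
      then obtain \<delta>1 where \<delta>1: "0 < \<delta>1"
        "\<And>z. z \<in> {p..q} \<Longrightarrow> \<bar>z - X y\<bar> < \<delta>1 \<Longrightarrow> \<bar>G z - G (X y) - \<phi> (X y) * (z - X y)\<bar> \<le> \<eta> * \<bar>z - X y\<bar>"
        unfolding has_field_derivative_def has_derivative_within_alt using \<eta>(1) by (auto simp: real_norm_def)
      have "isCont X y" "isCont (\<lambda>x. \<phi> (X x)) y"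
        using X \<phi>X y by (auto intro!: continuous_on_interior)
      then obtain \<delta>2 \<delta>3 where \<delta>23: "0 < \<delta>2" "\<And>z. \<bar>z - y\<bar> < \<delta>2 \<Longrightarrow> \<bar>X z - X y\<bar> < \<delta>1"
        "0 < \<delta>3" "\<And>z. \<bar>z - y\<bar> < \<delta>3 \<Longrightarrow> \<bar>\<phi> (X z) - \<phi> (X y)\<bar> < \<eta>"
        unfolding continuous_at_eps_delta dist_real_def using \<delta>1(1) \<eta>(1) by metis
      define \<delta> where "\<delta> = Min {\<delta>2, \<delta>3, y - a, b - y}"
      have "0 < \<delta>" using \<delta>23 y by (simp add: \<delta>_def)
      show "\<exists>d>0. \<forall>z. norm (z - y) < d \<longrightarrow>
          norm (G (X z) - Q z - (G (X y) - Q y) - 0 * (z - y)) \<le> e * norm (z - y)"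
      proof (intro exI conjI allI impI)
        show "0 < \<delta>" by fact
        fix z assume "norm (z - y) < \<delta>"
        then have z: "\<bar>z - y\<bar> < \<delta>2" "\<bar>z - y\<bar> < \<delta>3" "a < z" "z < b"
          by (auto simp: \<delta>_def)
        have "\<bar>Q z - Q y - \<phi> (X y) * (X z - X y)\<bar> \<le> \<eta> * M * \<bar>z - y\<bar> \<and> \<bar>X z - X y\<bar> \<le> M * \<bar>z - y\<bar>"
        proof (cases z y rule: linorder_cases)
          case less
          have "\<bar>Q y - Q z - \<phi> (X y) * (X y - X z)\<bar> \<le> \<eta> * M * (y - z)"
            using y z less by (intro Q_est order_less_imp_le[OF \<delta>23(4)]) auto
          moreover have "\<bar>Q y - Q z - \<phi> (X y) * (X y - X z)\<bar> = \<bar>Q z - Q y - \<phi> (X y) * (X z - X y)\<bar>"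
            by (subst abs_minus_cancel[symmetric]) (simp add: algebra_simps)
          ultimately show ?thesis using X_lip[of z y] y z less by (simp add: abs_minus_commute)
        next
          case greater
          have "\<bar>Q z - Q y - \<phi> (X y) * (X z - X y)\<bar> \<le> \<eta> * M * (z - y)"
            using y z greater by (intro Q_est order_less_imp_le[OF \<delta>23(4)]) auto
          then show ?thesis using X_lip[of y z] y z greater by simp
        qed simp
        moreover have "\<bar>G (X z) - G (X y) - \<phi> (X y) * (X z - X y)\<bar> \<le> \<eta> * \<bar>X z - X y\<bar>"
          using z by (intro \<delta>1 \<delta>23 subsetD[OF XI] imageI) auto
        moreover have "\<eta> * \<bar>X z - X y\<bar> \<le> \<eta> * (M * \<bar>z - y\<bar>)" if "\<bar>X z - X y\<bar> \<le> M * \<bar>z - y\<bar>"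
          using that \<eta> by (intro mult_left_mono) auto
        ultimately have "\<bar>G (X z) - Q z - (G (X y) - Q y)\<bar> \<le> 2 * (\<eta> * M) * \<bar>z - y\<bar>"
          by (simp add: mult.assoc) linarith
        also have "\<dots> \<le> e * \<bar>z - y\<bar>" using \<eta>(2) by (intro mult_right_mono) auto
        finally show "norm (G (X z) - Q z - (G (X y) - Q y) - 0 * (z - y)) \<le> e * norm (z - y)" by simp
      qed
    qed (rule bounded_linear_mult_right)
  qed
  then show ?thesis by (simp add: G_def Q_def)
qed

section \<open>Conservation in one upwind step\<close>

text \<open>Completeness of Lebesgue measure; it transfers measurability to the integrand built from
  the chosen Jacobian.\<close>

lemma borel_measurable_lebesgue_on_AE:
  fixes f g :: "real \<Rightarrow> real"
  assumes f: "f \<in> borel_measurable (lebesgue_on S)" and S: "S \<in> sets lebesgue"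
    and eq: "AE x in lebesgue_on S. f x = g x"
  shows "g \<in> borel_measurable (lebesgue_on S)"
proof -
  have "(\<lambda>x. f x * indicator S x) \<in> borel_measurable lebesgue"
    using f S by (subst (asm) borel_measurable_restrict_space_iff) (auto simp: mult.commute)
  moreover have "AE x in lebesgue. f x * indicator S x = g x * indicator S x"
    using eq S by (auto simp: AE_restrict_space_iff indicator_def elim: eventually_mono)
  ultimately have "(\<lambda>x. g x * indicator S x) \<in> borel_measurable lebesgue"
    by (rule borel_measurable_AE)
  then show ?thesis
    using S by (subst borel_measurable_restrict_space_iff) (auto simp: mult.commute)
qed

lemma has_weak_deriv_weak_deriv:
  "has_weak_deriv a b v w \<Longrightarrow> has_weak_deriv a b v (weak_deriv a b v)"
  unfolding weak_deriv_def by (metis someI_ex)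

text \<open>The chosen representative may be nonzero on a null set, hence only an almost everywhere
  claim.\<close>

lemma weak_deriv_const_AE: "AE x in lebesgue_on {a<..<b}. weak_deriv a b (\<lambda>x. k) x = 0"
proof -
  have "has_weak_deriv a b (\<lambda>x. k) (\<lambda>x. 0)"
    by (intro has_weak_deriv_classical) auto
  then show ?thesis
    by (intro has_weak_deriv_unique_AE) (auto intro: has_weak_deriv_weak_deriv)
qed

lemma Linf_norm_AE:
  assumes "Linf_norm a b w \<le> ereal B"
  shows "AE x in lebesgue_on {a<..<b}. \<bar>w x\<bar> \<le> B"
  using esssup_AE[of "\<lambda>x. ereal \<bar>w x\<bar>" "lebesgue_on {a<..<b}"]
proof eventually_elim
  case (elim x)
  then have "ereal \<bar>w x\<bar> \<le> ereal B" using assms unfolding Linf_norm_def by (rule order_trans)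
  then show ?case by simp
qed

text \<open>Monotonicity is known only inside the interval, as weak derivatives say nothing directly
  about endpoints; one-sided limits extend the bounds.\<close>

lemma image_subset_Icc_if_mono_on_Ioo:
  fixes X :: "real \<Rightarrow> real"
  assumes "a < b" and X: "continuous_on {a..b} X"
    and mono: "\<And>c d. a < c \<Longrightarrow> c < d \<Longrightarrow> d < b \<Longrightarrow> X c \<le> X d"
  shows "X ` {a..b} \<subseteq> {X a..X b}"
proof -
  have *: "X a \<le> X x \<and> X x \<le> X b" if x: "a < x" "x < b" for x
  proof
    have "(X \<longlongrightarrow> X a) (at_right a)" using X \<open>a < b\<close> by (rule continuous_on_Icc_at_rightD)
    then show "X a \<le> X x"
      by (rule tendsto_upperbound) (use x mono in \<open>auto simp: eventually_at_right_field\<close>)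
    have "(X \<longlongrightarrow> X b) (at_left b)" using X \<open>a < b\<close> by (rule continuous_on_Icc_at_leftD)
    then show "X x \<le> X b"
      by (rule tendsto_lowerbound) (use x mono in \<open>auto simp: eventually_at_left_field\<close>)
  qed
  have "X a \<le> X b" using *[of "(a + b) / 2"] \<open>a < b\<close> by simp
  show ?thesis
  proof (rule image_subsetI)
    fix x assume "x \<in> {a..b}"
    then consider "x = a" | "x = b" | "a < x" "x < b" by force
    then show "X x \<in> {X a..X b}" using * \<open>X a \<le> X b\<close> by cases auto
  qed
qed

text \<open>Since \<open>v\<close> vanishes at the boundary, the change of variables has limits
  \<open>a\<close> and \<open>b\<close>. Integrability is stated too, because the scheme's integral
  must be split.\<close>

lemma upwind_conservation:
  assumes "a < b" "0 < \<Delta>t" and v: "v \<in> W1inf0 a b"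
    and dt: "ereal \<Delta>t * Linf_norm a b (weak_deriv a b v) \<le> ereal (1 / 8)"
    and \<phi>: "continuous_on {a..b} \<phi>"
  defines "h \<equiv> \<lambda>x. \<phi> (upwind_map \<Delta>t v x) * upwind_jacobian a b \<Delta>t v x"
  shows "integrable (lebesgue_on {a<..<b}) h"
    and "(LINT x|lebesgue_on {a<..<b}. h x) = (LINT x|lebesgue_on {a<..<b}. \<phi> x)"
proof -
  let ?L = "lebesgue_on {a<..<b}"
  define X where "X = upwind_map \<Delta>t v"
  have X_eq: "X = (\<lambda>x. x - v x * \<Delta>t)" by (auto simp: X_def upwind_map_def)
  obtain w where w: "w \<in> Linf a b" "has_weak_deriv a b v w" and vc: "continuous_on {a..b} v"
    and v0: "v a = 0" "v b = 0"
    using v unfolding W1inf0_def W1inf_def by auto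
  have Xc: "continuous_on {a..b} X" unfolding X_eq using vc by (intro continuous_intros)
  have vo: "continuous_on {a<..<b} v" and Xo: "continuous_on {a<..<b} X"
    using vc Xc by (auto elim: continuous_on_subset)
  have "has_weak_deriv a b (\<lambda>x. x) (\<lambda>x. 1)" by (intro has_weak_deriv_classical) auto
  then have Xw: "has_weak_deriv a b X (\<lambda>x. 1 - w x * \<Delta>t)"
    unfolding X_eq using w(2) by (rule has_weak_deriv_diff_cmult)
  \<comment> \<open>An infinite norm would violate \<open>dt\<close>, since the time step is
    positive.\<close>
  have "Linf_norm a b (weak_deriv a b v) \<le> ereal (1 / 8 / \<Delta>t)"
    using dt \<open>0 < \<Delta>t\<close> by (cases "Linf_norm a b (weak_deriv a b v)") (auto simp: field_simps)
  then have "AE x in ?L. \<bar>weak_deriv a b v x\<bar> \<le> 1 / 8 / \<Delta>t" by (rule Linf_norm_AE)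
  moreover have "AE x in ?L. w x = weak_deriv a b v x"
    using w(2) has_weak_deriv_weak_deriv[OF w(2)] vo
    by (intro has_weak_deriv_unique_AE) auto
  ultimately have wb: "AE x in ?L. \<bar>w x * \<Delta>t\<bar> \<le> 1 / 8"
    by eventually_elim (use \<open>0 < \<Delta>t\<close> in \<open>simp add: field_simps abs_mult\<close>)
  \<comment> \<open>The clamping turns the almost everywhere bounds on the Jacobian into pointwise ones.\<close>
  define \<gamma> where "\<gamma> = (\<lambda>x. max (7 / 8) (min (9 / 8) (1 - w x * \<Delta>t)))"
  \<comment> \<open>Where \<open>wb\<close> holds, the unclamped value already lies in
    \<open>[7/8, 9/8]\<close>.\<close>
  have \<gamma>w: "AE x in ?L. 1 - w x * \<Delta>t = \<gamma> x"
    using wb by eventually_elim (auto simp: \<gamma>_def)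
  have \<gamma>b: "\<bar>\<gamma> x\<bar> \<le> 9 / 8" "0 \<le> \<gamma> x" for x by (simp_all add: \<gamma>_def max_def min_def)
  have \<gamma>m: "\<gamma> \<in> borel_measurable ?L"
  proof -
    have [measurable]: "w \<in> borel_measurable ?L" using w(1) by (simp add: Linf_def)
    show ?thesis unfolding \<gamma>_def by measurable
  qed
  have "\<gamma> absolutely_integrable_on {a<..<b}"
  proof (rule measurable_bounded_by_integrable_imp_absolutely_integrable[OF \<gamma>m])
    show "(\<lambda>x. 9 / 8 :: real) integrable_on {a<..<b}"
      by (intro integrable_on_const) simp
    show "norm (\<gamma> x) \<le> 9 / 8" for x using \<gamma>b(1) by simp
  qed simp
  then have \<gamma>i: "\<gamma> absolutely_integrable_on {a..b}"
    by (simp add: absolutely_integrable_on_Icc_iff_Ioo)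
  have X_diff: "integral {c..d} \<gamma> = X d - X c" if cd: "a < c" "c < d" "d < b" for c d
  proof -
    have "AE x in lebesgue. x \<in> {a<..<b} \<longrightarrow> 1 - w x * \<Delta>t = \<gamma> x"
      using \<gamma>w by (simp add: AE_restrict_space_iff)
    then obtain N where N: "negligible N" "{x. \<not> (x \<in> {a<..<b} \<longrightarrow> 1 - w x * \<Delta>t = \<gamma> x)} \<subseteq> N"
      unfolding eventually_ae_filter_negligible by blast
    have "integral {c..d} \<gamma> = integral {c..d} (\<lambda>x. 1 - w x * \<Delta>t)"
    proof (rule integral_spike[OF N(1)])
      fix x assume "x \<in> {c..d} - N"
      then have "x \<in> {a<..<b}" "x \<notin> N" using cd by auto
      then show "1 - w x * \<Delta>t = \<gamma> x" using N(2) by blast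
    qed
    also have "\<dots> = X d - X c"
      using integral_weak_deriv[OF Xw _ cd] Xo by auto
    finally show ?thesis .
  qed
  have ends: "X a = a" "X b = b" using v0 by (auto simp: X_eq)
  have XI: "X ` {a..b} \<subseteq> {a..b}"
  proof -
    have "X c \<le> X d" if cd: "a < c" "c < d" "d < b" for c d
    proof -
      have "0 \<le> integral {c..d} \<gamma>"
        using cd \<gamma>b by (intro integral_nonneg integrable_on_subinterval[OF set_lebesgue_integral_eq_integral(1)[OF \<gamma>i]]) auto
      then show ?thesis using X_diff[OF cd] by simp
    qed
    then show ?thesis using image_subset_Icc_if_mono_on_Ioo[OF \<open>a < b\<close> Xc] ends by simp
  qed
  have \<phi>X: "continuous_on {a..b} (\<lambda>x. \<phi> (X x))"
    using XI by (intro continuous_on_compose2[OF \<phi> Xc]) auto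
  have hi: "(\<lambda>x. \<phi> (X x) * \<gamma> x) absolutely_integrable_on {a<..<b}"
    using absolutely_integrable_continuous_mult[OF \<gamma>i \<phi>X]
    by (simp add: absolutely_integrable_on_Icc_iff_Ioo mult.commute)
  then have hL: "integrable ?L (\<lambda>x. \<phi> (X x) * \<gamma> x)"
    by (simp add: integrable_restrict_space set_integrable_def)
  \<comment> \<open>Uniqueness identifies the arbitrarily chosen Jacobian with the explicit
    one.\<close>
  have "AE x in ?L. 1 - w x * \<Delta>t = upwind_jacobian a b \<Delta>t v x"
    unfolding upwind_jacobian_def X_def[symmetric]
    using Xw has_weak_deriv_weak_deriv[OF Xw] Xo
    by (intro has_weak_deriv_unique_AE[of _ _ X]) auto
  then have eq: "AE x in ?L. \<phi> (X x) * \<gamma> x = h x"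
    using \<gamma>w by eventually_elim (simp add: h_def X_def)
  have hm: "h \<in> borel_measurable ?L"
    using borel_measurable_lebesgue_on_AE[OF borel_measurable_integrable[OF hL] _ eq] by simp
  show "integrable ?L h"
    using hL hm eq integrable_cong_AE_imp by blast
  have "(LINT x|?L. h x) = (LINT x|?L. \<phi> (X x) * \<gamma> x)"
    using hL hm eq by (intro integral_cong_AE) auto
  also have "\<dots> = integral {a..b} (\<lambda>x. \<phi> (X x) * \<gamma> x)"
    using hL by (simp add: lebesgue_integral_eq_integral integral_open_interval_real)
  also have "\<dots> = integral {a..b} \<phi>"
    using integral_compose_indefinite_integral[OF \<open>a < b\<close> Xc \<gamma>i \<gamma>b(1) X_diff XI \<phi>] ends by simp
  also have "\<dots> = (LINT x|?L. \<phi> x)"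
  proof -
    have "\<phi> absolutely_integrable_on {a<..<b}"
      using absolutely_integrable_continuous_real[OF \<phi>] by (simp add: absolutely_integrable_on_Icc_iff_Ioo)
    then have "integrable ?L \<phi>" by (simp add: integrable_restrict_space set_integrable_def)
    then show ?thesis by (simp add: lebesgue_integral_eq_integral integral_open_interval_real)
  qed
  finally show "(LINT x|?L. h x) = (LINT x|?L. \<phi> x)" .
qed

section \<open>Mass balance of the scheme\<close>

theorem corollary2:
  fixes a b T \<nu> \<Delta>t :: real
    and u f g :: "real \<Rightarrow> real \<Rightarrow> real"
    and Np :: nat
    and P :: "nat \<Rightarrow> nat \<Rightarrow> real"
    and \<phi> :: "nat \<Rightarrow> real \<Rightarrow> real"
  assumes "a < b" and "0 < T" and "0 < \<nu>" and "0 < \<Delta>t"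
    and f: "\<And>t. t \<in> {0<..T} \<Longrightarrow> f t \<in> L2 a b"
    and u: "u \<in> C_W1inf0 T a b"
    and mesh: "moving_mesh a b (num_steps T \<Delta>t) Np P"
    and dt: "ereal \<Delta>t * C_W1inf_seminorm T a b u \<le> ereal (1 / 8)"
    and phi: "\<And>n. n \<le> num_steps T \<Delta>t \<Longrightarrow> \<phi> n \<in> P1_space a b Np (P n)"
    and scheme: "\<And>n \<psi>. n \<in> {1..num_steps T \<Delta>t} \<Longrightarrow> \<psi> \<in> P1_space a b Np (P n) \<Longrightarrow>
      L2_inner a b
        (\<lambda>x. (\<phi> n x - \<phi> (n - 1) (upwind_map \<Delta>t (u (real n * \<Delta>t)) x)
                 * upwind_jacobian a b \<Delta>t (u (real n * \<Delta>t)) x) / \<Delta>t) \<psi>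
      + \<nu> * L2_inner a b (weak_deriv a b (\<phi> n)) (weak_deriv a b \<psi>)
      = L2_inner a b (f (real n * \<Delta>t)) \<psi>
        + boundary_integral a b (\<lambda>x. g (real n * \<Delta>t) x * \<psi> x)"
  shows "\<forall>n \<le> num_steps T \<Delta>t.
    (LINT x|lebesgue_on {a<..<b}. \<phi> n x) =
    (LINT x|lebesgue_on {a<..<b}. \<phi> 0 x)
    + \<Delta>t * (\<Sum>i = 1..n. (LINT x|lebesgue_on {a<..<b}. f (real i * \<Delta>t) x)
                       + boundary_integral a b (g (real i * \<Delta>t)))"
proof -
  let ?L = "lebesgue_on {a<..<b}"
  have step: "(LINT x|?L. \<phi> n x) = (LINT x|?L. \<phi> (n - 1) x)
      + \<Delta>t * ((LINT x|?L. f (real n * \<Delta>t) x) + boundary_integral a b (g (real n * \<Delta>t)))"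
    if n: "n \<in> {1..num_steps T \<Delta>t}" for n
  proof -
    let ?t = "real n * \<Delta>t"
    let ?h = "\<lambda>x. \<phi> (n - 1) (upwind_map \<Delta>t (u ?t) x) * upwind_jacobian a b \<Delta>t (u ?t) x"
    \<comment> \<open>The floor in \<open>num_steps\<close> keeps the time level within
      \<open>[0, T]\<close>, where the seminorm controls \<open>u\<close>.\<close>
    have t: "?t \<in> {0..T}"
    proof -
      have "real n \<le> T / \<Delta>t"
        using n \<open>0 < T\<close> \<open>0 < \<Delta>t\<close> by (simp add: num_steps_def le_nat_floor nat_le_iff) linarith
      then show ?thesis using \<open>0 < \<Delta>t\<close> by (simp add: field_simps)
    qed
    have "Linf_norm a b (weak_deriv a b (u ?t)) \<le> C_W1inf_seminorm T a b u"
      unfolding C_W1inf_seminorm_def using t by (rule SUP_upper)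
    then have "ereal \<Delta>t * Linf_norm a b (weak_deriv a b (u ?t)) \<le> ereal (1 / 8)"
      using \<open>0 < \<Delta>t\<close> by (intro order_trans[OF ereal_mult_left_mono dt]) auto
    moreover have "u ?t \<in> W1inf0 a b" using u t by (auto simp: C_W1inf0_def)
    moreover have \<phi>c: "continuous_on {a..b} (\<phi> k)" if "k \<le> num_steps T \<Delta>t" for k
      using phi[OF that] by (simp add: P1_space_def)
    have "continuous_on {a..b} (\<phi> (n - 1))" using n by (intro \<phi>c) auto
    ultimately have h: "integrable ?L ?h" "(LINT x|?L. ?h x) = (LINT x|?L. \<phi> (n - 1) x)"
      using upwind_conservation[OF \<open>a < b\<close> \<open>0 < \<Delta>t\<close>] by auto
    have "\<phi> n absolutely_integrable_on {a<..<b}"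
      using absolutely_integrable_continuous_real[OF \<phi>c[of n]] n
      by (simp add: absolutely_integrable_on_Icc_iff_Ioo)
    then have \<phi>i: "integrable ?L (\<phi> n)" by (simp add: integrable_restrict_space set_integrable_def)
    \<comment> \<open>Constants are affine on every cell of every mesh: intercept 1, slope
      0.\<close>
    have "(\<lambda>x. 1) \<in> P1_space a b Np (P n)"
      unfolding P1_space_def by (auto intro: exI[of _ "1::real", OF exI[of _ "0::real"]])
    from scheme[OF n this]
    have "(LINT x|?L. (\<phi> n x - ?h x) / \<Delta>t) + \<nu> * L2_inner a b (weak_deriv a b (\<phi> n)) (weak_deriv a b (\<lambda>x. 1))
        = (LINT x|?L. f ?t x) + boundary_integral a b (g ?t)"
      by (simp add: L2_inner_def)
    moreover have "L2_inner a b (weak_deriv a b (\<phi> n)) (weak_deriv a b (\<lambda>x. 1)) = 0"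
      unfolding L2_inner_def
      using weak_deriv_const_AE[of a b 1] by (intro integral_eq_zero_AE) (auto elim: eventually_mono)
    moreover have "(LINT x|?L. (\<phi> n x - ?h x) / \<Delta>t) = ((LINT x|?L. \<phi> n x) - (LINT x|?L. \<phi> (n - 1) x)) / \<Delta>t"
      using \<phi>i h by simp
    ultimately show ?thesis using \<open>0 < \<Delta>t\<close> by (simp add: field_simps)
  qed
  show ?thesis
  proof (intro allI impI)
    fix n assume "n \<le> num_steps T \<Delta>t"
    then show "(LINT x|?L. \<phi> n x) = (LINT x|?L. \<phi> 0 x)
      + \<Delta>t * (\<Sum>i = 1..n. (LINT x|?L. f (real i * \<Delta>t) x) + boundary_integral a b (g (real i * \<Delta>t)))"
    \<comment> \<open>The one-step balances telescope.\<close>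
    proof (induction n)
      case (Suc n)
      then show ?case using step[of "Suc n"] by (simp add: distrib_left)
    qed simp
  qed
qed

end
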